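(* Let $\mathbb{F}$ be an algebraically closed field of characteristic $2$. The $O(V)$-equivariant vector space isomorphism $\tilde\Psi:V\oplus\mathfrak{o}(V)\to\mathfrak{o}(\tilde V)$, $(v,x)\mapsto\delta(v)+i(x)$, restricts to an $O(V)$-equivariant (but not $O(\tilde V)$-equivariant) isomorphism of varieties $\mathfrak{N}\to\mathcal{N}(\mathfrak{o}(\tilde V))$.
   Context: $n$ is a nonnegative integer. $V$ is a $2n$-dimensional $\mathbb{F}$-vector space with basis $e_1,\dots,e_{2n}$ and quadratic form $Q(\sum a_ie_i)=a_1a_{2n}+a_2a_{2n-1}+\cdots+a_na_{n+1}$, whose associated form $\langle v,w\rangle=Q(v+w)-Q(v)-Q(w)$ is nondegenerate and alternating. $O(V)\subseteq Sp(V)$ are the stabilizers in $GL(V)$ of $Q$ and of $\langle\cdot,\cdot\rangle$ respectively. $\mathfrak{o}(V)=\{x\in\mathrm{End}(V):\langle xv,v\rangle=0\ \forall v\in V\}$. The exotic nilpotent cone is $\mathfrak{N}=\{(v,x)\in V\oplus\mathfrak{o}(V):x\text{ nilpotent}\}$, with its $Sp(V)$-action. $\tilde V=\mathbb{F}e_0\oplus V$, where $\mathbb{F}e_0$ is one-dimensional with basis $e_0$, with quadratic form $\tilde Q(ae_0+v)=a^2+Q(v)$ for $a\in\mathbb{F}$, $v\in V$; the associated alternating form on $\tilde V$, also denoted $\langle\cdot,\cdot\rangle$, has radical $\mathbb{F}e_0$ and restricts to the given form on $V$. $O(\tilde V)$ is the stabilizer of $\tilde Q$ in $GL(\tilde V)$;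 it fixes $e_0$, and the subgroup preserving $V$ is identified with $O(V)$. Identifying $V$ with $\tilde V/\mathbb{F}e_0$ gives a homomorphism (a bijective isogeny) $\Gamma:O(\tilde V)\to Sp(V)$, through which $O(\tilde V)$ acts on $V$, $\mathfrak{o}(V)$ and $\mathfrak{N}$. The Lie algebra of $O(\tilde V)$ is $\mathfrak{o}(\tilde V)=\{y\in\mathrm{End}(\tilde V):ye_0=0,\ \langle yv,v\rangle=0\ \forall v\in V\}$, and $\mathcal{N}(\mathfrak{o}(\tilde V))$ is the variety of its nilpotent elements, with the adjoint action. $\delta:V\to\mathfrak{o}(\tilde V)$ sends $v$ to the endomorphism $w\mapsto\langle v,w\rangle e_0$ of $\tilde V$. $i:\mathfrak{o}(V)\to\mathfrak{o}(\tilde V)$ is the embedding extending $x$ by $xe_0=0$, whose image consists of the endomorphisms in $\mathfrak{o}(\tilde V)$ preserving $V$.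
   Formalization: The claim "but not O(Ṽ)-equivariant" is stated only for n ≥ 2: for n = 0 and n = 1 every nilpotent x in o(V) is 0, so the restricted map is δ on V, which is O(Ṽ)-equivariant. *)

theory Defs
  imports
    "HOL-Analysis.Product_Vector"
    "HOL-Library.Function_Algebras"
    "HOL-Computational_Algebra.Polynomial"
begin

text \<open>
  A vector space over a field is given by its scalar multiplication
  \<open>s :: 'a \<Rightarrow> 'v \<Rightarrow> 'v\<close>, in the style of \<^theory>\<open>HOL.Vector_Spaces\<close>.
  Products carry the library's \<^const>\<open>module_prod.scale\<close>; functions carry the pointwise
  operations, of which addition comes from \<^theory>\<open>HOL-Library.Function_Algebras\<close>.
\<close>

definition fun_scale :: "('a \<Rightarrow> 'w \<Rightarrow> 'w) \<Rightarrow> 'a \<Rightarrow> ('u \<Rightarrow> 'w) \<Rightarrow> 'u \<Rightarrow> 'w" where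
  "fun_scale s c f = (\<lambda>u. s c (f u))"

section \<open>Linear maps and polynomial maps on subspaces\<close>

definition linear_on ::
  "('a \<Rightarrow> 'w::plus \<Rightarrow> 'w) \<Rightarrow> ('a \<Rightarrow> 'u::plus \<Rightarrow> 'u) \<Rightarrow> 'w set \<Rightarrow> ('w \<Rightarrow> 'u) \<Rightarrow> bool" where
  "linear_on s t W f \<longleftrightarrow>
     (\<forall>x\<in>W. \<forall>y\<in>W. f (x + y) = f x + f y) \<and> (\<forall>c. \<forall>x\<in>W. f (s c x) = t c (f x))"

definition vs_iso ::
  "('a::field \<Rightarrow> 'w::ab_group_add \<Rightarrow> 'w) \<Rightarrow> ('a \<Rightarrow> 'u::ab_group_add \<Rightarrow> 'u)
     \<Rightarrow> 'w set \<Rightarrow> 'u set \<Rightarrow> ('w \<Rightarrow> 'u) \<Rightarrow> bool" where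
  "vs_iso s t W U f \<longleftrightarrow>
     module.subspace s W \<and> module.subspace t U \<and> linear_on s t W f \<and> bij_betw f W U"

text \<open>
  The polynomial functions on \<open>W\<close> form the algebra generated by the linear functionals on \<open>W\<close>;
  for finite-dimensional \<open>W\<close> these are the polynomials in the coordinates with respect to any basis.
  Only the values on \<open>W\<close> are meaningful.
\<close>

inductive polynomial_function ::
  "('a::field \<Rightarrow> 'w::plus \<Rightarrow> 'w) \<Rightarrow> 'w set \<Rightarrow> ('w \<Rightarrow> 'a) \<Rightarrow> bool"
  for s W where
  const: "polynomial_function s W (\<lambda>_. c)"
| functional: "linear_on s (*) W l \<Longrightarrow> polynomial_function s W l"
| add: "polynomial_function s W f \<Longrightarrow> polynomial_function s W g
          \<Longrightarrow> polynomial_function s W (\<lambda>x. f x + g x)"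
| mult: "polynomial_function s W f \<Longrightarrow> polynomial_function s W g
          \<Longrightarrow> polynomial_function s W (\<lambda>x. f x * g x)"

text \<open>
  Over an algebraically closed field, an affine variety is a Zariski-closed subset \<open>X\<close> of a
  finite-dimensional vector space \<open>W\<close> (not required to be irreducible), its regular functions are
  the restrictions of the polynomial functions on \<open>W\<close>, and a map between varieties is a morphism
  when it pulls regular functions back to regular functions.
\<close>

definition zariski_closed_in ::
  "('a::field \<Rightarrow> 'w::plus \<Rightarrow> 'w) \<Rightarrow> 'w set \<Rightarrow> 'w set \<Rightarrow> bool" where
  "zariski_closed_in s W X \<longleftrightarrow>
     (\<exists>P. (\<forall>p\<in>P. polynomial_function s W p) \<and> X = {x \<in> W. \<forall>p\<in>P. p x = 0})"

definition regular_function ::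
  "('a::field \<Rightarrow> 'w::plus \<Rightarrow> 'w) \<Rightarrow> 'w set \<Rightarrow> 'w set \<Rightarrow> ('w \<Rightarrow> 'a) \<Rightarrow> bool" where
  "regular_function s W X f \<longleftrightarrow> (\<exists>p. polynomial_function s W p \<and> (\<forall>x\<in>X. f x = p x))"

definition variety_morphism ::
  "('a::field \<Rightarrow> 'w::plus \<Rightarrow> 'w) \<Rightarrow> ('a \<Rightarrow> 'u::plus \<Rightarrow> 'u)
     \<Rightarrow> 'w set \<Rightarrow> 'u set \<Rightarrow> 'w set \<Rightarrow> 'u set \<Rightarrow> ('w \<Rightarrow> 'u) \<Rightarrow> bool" where
  "variety_morphism s t W U X Y \<phi> \<longleftrightarrow>
     \<phi> ` X \<subseteq> Y \<and> (\<forall>f. regular_function t U Y f \<longrightarrow> regular_function s W X (f \<circ> \<phi>))"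

definition variety_iso ::
  "('a::field \<Rightarrow> 'w::plus \<Rightarrow> 'w) \<Rightarrow> ('a \<Rightarrow> 'u::plus \<Rightarrow> 'u)
     \<Rightarrow> 'w set \<Rightarrow> 'u set \<Rightarrow> 'w set \<Rightarrow> 'u set \<Rightarrow> ('w \<Rightarrow> 'u) \<Rightarrow> bool" where
  "variety_iso s t W U X Y \<phi> \<longleftrightarrow>
     zariski_closed_in s W X \<and> zariski_closed_in t U Y \<and> bij_betw \<phi> X Y \<and>
     variety_morphism s t W U X Y \<phi> \<and> variety_morphism t s U W Y X (inv_into X \<phi>)"

definition equivariant_on ::
  "'g set \<Rightarrow> ('g \<Rightarrow> 'x \<Rightarrow> 'x) \<Rightarrow> ('g \<Rightarrow> 'y \<Rightarrow> 'y) \<Rightarrow> 'x set \<Rightarrow> ('x \<Rightarrow> 'y) \<Rightarrow> bool" where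
  "equivariant_on G act act' X f \<longleftrightarrow> (\<forall>g\<in>G. \<forall>x\<in>X. f (act g x) = act' g (f x))"

section \<open>Quadratic forms, endomorphisms and stabilizers\<close>

definition is_basis :: "('a::field \<Rightarrow> 'v::ab_group_add \<Rightarrow> 'v) \<Rightarrow> nat \<Rightarrow> (nat \<Rightarrow> 'v) \<Rightarrow> bool" where
  "is_basis s m e \<longleftrightarrow> inj_on e {1..m} \<and> \<not> module.dependent s (e ` {1..m}) \<and>
     module.span s (e ` {1..m}) = UNIV"

definition coord ::
  "('a::field \<Rightarrow> 'v::ab_group_add \<Rightarrow> 'v) \<Rightarrow> nat \<Rightarrow> (nat \<Rightarrow> 'v) \<Rightarrow> 'v \<Rightarrow> nat \<Rightarrow> 'a" where
  "coord s m e v i = module.representation s (e ` {1..m}) v (e i)"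

definition quad_form ::
  "('a::field \<Rightarrow> 'v::ab_group_add \<Rightarrow> 'v) \<Rightarrow> nat \<Rightarrow> (nat \<Rightarrow> 'v) \<Rightarrow> 'v \<Rightarrow> 'a" where
  "quad_form s n e v =
     (\<Sum>i=1..n. coord s (2 * n) e v i * coord s (2 * n) e v (2 * n + 1 - i))"

definition assoc_form :: "('v::ab_group_add \<Rightarrow> 'a::ab_group_add) \<Rightarrow> 'v \<Rightarrow> 'v \<Rightarrow> 'a" where
  "assoc_form Q v w = Q (v + w) - Q v - Q w"

definition End :: "('a::field \<Rightarrow> 'v::ab_group_add \<Rightarrow> 'v) \<Rightarrow> ('v \<Rightarrow> 'v) set" where
  "End s = {x. Vector_Spaces.linear s s x}"

definition GL :: "('a::field \<Rightarrow> 'v::ab_group_add \<Rightarrow> 'v) \<Rightarrow> ('v \<Rightarrow> 'v) set" where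
  "GL s = {g \<in> End s. bij g}"

definition O_group ::
  "('a::field \<Rightarrow> 'v::ab_group_add \<Rightarrow> 'v) \<Rightarrow> ('v \<Rightarrow> 'a) \<Rightarrow> ('v \<Rightarrow> 'v) set" where
  "O_group s Q = {g \<in> GL s. \<forall>v. Q (g v) = Q v}"

definition nilpotent :: "('v::zero \<Rightarrow> 'v) \<Rightarrow> bool" where
  "nilpotent x \<longleftrightarrow> (\<exists>k. x ^^ k = (\<lambda>_. 0))"

definition conj_act :: "('v \<Rightarrow> 'v) \<Rightarrow> ('v \<Rightarrow> 'v) \<Rightarrow> 'v \<Rightarrow> 'v" where
  "conj_act g x = g \<circ> x \<circ> inv g"

section \<open>The space \<open>V\<close> and the exotic nilpotent cone\<close>

definition o_V ::
  "('a::field \<Rightarrow> 'v::ab_group_add \<Rightarrow> 'v) \<Rightarrow> ('v \<Rightarrow> 'a) \<Rightarrow> ('v \<Rightarrow> 'v) set" where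
  "o_V s Q = {x \<in> End s. \<forall>v. assoc_form Q (x v) v = 0}"

definition V_plus_o ::
  "('a::field \<Rightarrow> 'v::ab_group_add \<Rightarrow> 'v) \<Rightarrow> ('v \<Rightarrow> 'a) \<Rightarrow> ('v \<times> ('v \<Rightarrow> 'v)) set" where
  "V_plus_o s Q = UNIV \<times> o_V s Q"

abbreviation V_plus_o_scale ::
  "('a::field \<Rightarrow> 'v::ab_group_add \<Rightarrow> 'v) \<Rightarrow> 'a \<Rightarrow> 'v \<times> ('v \<Rightarrow> 'v) \<Rightarrow> 'v \<times> ('v \<Rightarrow> 'v)" where
  "V_plus_o_scale s \<equiv> module_prod.scale s (fun_scale s)"

definition exotic_nilcone ::
  "('a::field \<Rightarrow> 'v::ab_group_add \<Rightarrow> 'v) \<Rightarrow> ('v \<Rightarrow> 'a) \<Rightarrow> ('v \<times> ('v \<Rightarrow> 'v)) set" where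
  "exotic_nilcone s Q = {(v, x) \<in> V_plus_o s Q. nilpotent x}"

definition V_plus_o_act :: "('v \<Rightarrow> 'v) \<Rightarrow> 'v \<times> ('v \<Rightarrow> 'v) \<Rightarrow> 'v \<times> ('v \<Rightarrow> 'v)" where
  "V_plus_o_act g = (\<lambda>(v, x). (g v, conj_act g x))"

section \<open>The space \<open>V\<^sup>~ = F e\<^sub>0 \<oplus> V\<close>\<close>

text \<open>
  \<open>V\<^sup>~\<close> is the product \<open>'a \<times> 'v\<close>, the pair \<open>(a, v)\<close> standing for \<open>a e\<^sub>0 + v\<close>.
  Hence \<^const>\<open>snd\<close> is the quotient map from \<open>V\<^sup>~\<close> to \<open>V\<^sup>~ / F e\<^sub>0 = V\<close>.
\<close>

abbreviation tscale :: "('a::field \<Rightarrow> 'v::ab_group_add \<Rightarrow> 'v) \<Rightarrow> 'a \<Rightarrow> 'a \<times> 'v \<Rightarrow> 'a \<times> 'v" where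
  "tscale s \<equiv> module_prod.scale (*) s"

definition e\<^sub>0 :: "'a::field \<times> 'v::ab_group_add" where
  "e\<^sub>0 = (1, 0)"

definition incl :: "'v \<Rightarrow> 'a::field \<times> 'v" where
  "incl v = (0, v)"

definition tQ :: "('v \<Rightarrow> 'a::field) \<Rightarrow> 'a \<times> 'v \<Rightarrow> 'a" where
  "tQ Q = (\<lambda>(a, v). a\<^sup>2 + Q v)"

definition extend_O :: "('v \<Rightarrow> 'v) \<Rightarrow> 'a::field \<times> 'v \<Rightarrow> 'a \<times> 'v" where
  "extend_O g = (\<lambda>(a, v). (a, g v))"

definition \<Gamma> :: "('a::field \<times> 'v \<Rightarrow> 'a \<times> 'v) \<Rightarrow> 'v \<Rightarrow> 'v" where
  "\<Gamma> h v = snd (h (incl v))"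

definition o_tV ::
  "('a::field \<Rightarrow> 'v::ab_group_add \<Rightarrow> 'v) \<Rightarrow> ('v \<Rightarrow> 'a) \<Rightarrow> ('a \<times> 'v \<Rightarrow> 'a \<times> 'v) set" where
  "o_tV s Q = {y \<in> End (tscale s). y e\<^sub>0 = 0 \<and>
     (\<forall>v. assoc_form (tQ Q) (y (incl v)) (incl v) = 0)}"

definition nilcone_o_tV ::
  "('a::field \<Rightarrow> 'v::ab_group_add \<Rightarrow> 'v) \<Rightarrow> ('v \<Rightarrow> 'a) \<Rightarrow> ('a \<times> 'v \<Rightarrow> 'a \<times> 'v) set" where
  "nilcone_o_tV s Q = {y \<in> o_tV s Q. nilpotent y}"

definition \<delta> ::
  "('a::field \<Rightarrow> 'v::ab_group_add \<Rightarrow> 'v) \<Rightarrow> ('v \<Rightarrow> 'a) \<Rightarrow> 'v \<Rightarrow> 'a \<times> 'v \<Rightarrow> 'a \<times> 'v" where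
  "\<delta> s Q v = (\<lambda>w. tscale s (assoc_form (tQ Q) (incl v) w) e\<^sub>0)"

definition i_emb :: "('v \<Rightarrow> 'v) \<Rightarrow> 'a::field \<times> 'v \<Rightarrow> 'a \<times> 'v" where
  "i_emb x = (\<lambda>(a, v). incl (x v))"

definition t\<Psi> ::
  "('a::field \<Rightarrow> 'v::ab_group_add \<Rightarrow> 'v) \<Rightarrow> ('v \<Rightarrow> 'a) \<Rightarrow>
     'v \<times> ('v \<Rightarrow> 'v) \<Rightarrow> 'a \<times> 'v \<Rightarrow> 'a \<times> 'v" where
  "t\<Psi> s Q = (\<lambda>(v, x). \<delta> s Q v + i_emb x)"

end

theory Submission
  imports Defs
begin

text \<open>
  Everything is read off from the matrix form of the map: with \<open>B\<close> the associated bilinear form,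
  \<open>t\<Psi> (v, x)\<close> sends \<open>(a, w)\<close> to \<open>(B v w, x w)\<close> (\<open>t\<Psi>_apply\<close>).

  An element of \<open>o_tV\<close> kills \<open>e\<^sub>0\<close>, so it has the form \<open>(a, w) \<mapsto> (f w, x w)\<close> with \<open>f\<close> a linear
  functional and \<open>x\<close> an endomorphism of \<open>V\<close>.  In characteristic two the square in \<open>tQ\<close> contributes
  nothing to the associated form, so the condition on this element says exactly that \<open>x\<close> lies in
  \<open>o_V\<close>; and nondegeneracy of \<open>B\<close> says exactly that \<open>f = B v\<close> for a unique \<open>v\<close>.  This is the vector
  space isomorphism (\<open>vs_iso_t\<Psi>\<close>).  It commutes with \<open>O(V)\<close> because \<open>O(V)\<close> preserves \<open>B\<close>.

  The \<open>(k + 1)\<close>-st power of \<open>t\<Psi> (v, x)\<close> is \<open>(a, w) \<mapsto> (B v (x ^^ k w), x ^^ (k + 1) w)\<close>, so \<open>t\<Psi> (v, x)\<close> is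
  nilpotent precisely when \<open>x\<close> is (\<open>nilpotent_t\<Psi>_iff\<close>).  Hence the two cones correspond.  The
  exotic cone is closed, being cut out by the entries of \<open>x ^^ (2 * n)\<close>
  (\<open>zariski_closed_exotic_nilcone\<close>), and a linear isomorphism carries polynomial functions to
  polynomial functions in both directions, so it identifies any closed subset with its image as
  varieties (\<open>vs_iso_imp_variety_iso\<close>).

  Equivariance fails for the larger group as soon as some element of \<open>O_group (tscale s) (tQ Q)\<close>
  mixes \<open>V\<close> into \<open>e\<^sub>0\<close> on the image of a nilpotent \<open>x\<close>.  The lift to \<open>F e\<^sub>0 \<oplus> V\<close> of the symplectic
  transvection at a singular vector \<open>u\<close> is such an element once \<open>B u \<circ> x \<noteq> 0\<close>, and for \<open>n \<ge> 2\<close> there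
  is a nilpotent \<open>x\<close> of rank two with this property (\<open>not_equivariant_t\<Psi>\<close>).
\<close>

section \<open>Polynomial functions and linear isomorphisms\<close>

text \<open>
  Pulling back along a linear map turns a linear functional into a linear functional and respects
  sums and products, hence preserves the algebra that the functionals generate.
\<close>

lemma polynomial_function_compose_linear:
  assumes "polynomial_function t U f" and lin: "linear_on s t W \<phi>" and img: "\<phi> ` W \<subseteq> U"
  shows "polynomial_function s W (f \<circ> \<phi>)"
  using assms(1)
proof (induction rule: polynomial_function.induct)
  case (const c)
  then show ?case by (simp add: comp_def polynomial_function.const)
next
  case (functional l)
  then have "linear_on s (*) W (l \<circ> \<phi>)"
    using lin img by (auto simp: linear_on_def image_subset_iff)
  then show ?case by (rule polynomial_function.functional)
next
  case (add f g)
  from polynomial_function.add[OF add.IH] show ?case by (simp add: comp_def)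
next
  case (mult f g)
  from polynomial_function.mult[OF mult.IH] show ?case by (simp add: comp_def)
qed

text \<open>
  Only the values on \<open>W\<close> matter: the difference of two functions that agree on \<open>W\<close> vanishes there,
  so it counts as a linear functional on \<open>W\<close>.
\<close>

lemma polynomial_function_cong:
  assumes "module s" and W: "module.subspace s W"
    and p: "polynomial_function s W p" and eq: "\<And>x. x \<in> W \<Longrightarrow> f x = p x"
  shows "polynomial_function s W f"
proof -
  interpret module s by fact
  have "linear_on s (*) W (\<lambda>x. f x - p x)"
    using subspace_add[OF W] subspace_scale[OF W] by (simp add: linear_on_def eq)
  from polynomial_function.add[OF p polynomial_function.functional[OF this]]
  show ?thesis by simp
qed

lemma polynomial_function_sum:
  assumes "\<And>i. i \<in> I \<Longrightarrow> polynomial_function s W (f i)"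
  shows "polynomial_function s W (\<lambda>x. \<Sum>i\<in>I. f i x)"
  using assms
  by (induction I rule: infinite_finite_induct)
    (auto intro: polynomial_function.const polynomial_function.add)

lemma vs_iso_inv:
  assumes "module s" and iso: "vs_iso s t W U \<phi>"
  shows "vs_iso t s U W (inv_into W \<phi>)"
proof -
  interpret module s by fact
  let ?\<psi> = "inv_into W \<phi>"
  have W: "subspace W" and bij: "bij_betw \<phi> W U" and lin: "linear_on s t W \<phi>"
    using iso by (auto simp: vs_iso_def)
  have \<psi>: "?\<psi> y \<in> W" "\<phi> (?\<psi> y) = y" if "y \<in> U" for y
    using that bij by (auto simp: bij_betw_def inv_into_into f_inv_into_f)
  have inv: "?\<psi> y = x" if "x \<in> W" "\<phi> x = y" for x y
    using that bij by (auto simp: bij_betw_def)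
  have "linear_on t s U ?\<psi>"
    unfolding linear_on_def
    using \<psi> lin W by (auto intro!: inv simp: linear_on_def subspace_add subspace_scale)
  then show ?thesis
    using iso bij_betw_inv_into[OF bij] by (simp add: vs_iso_def)
qed

text \<open>
  The map \<open>\<phi>'\<close> is separate from \<open>\<phi>\<close> because \<^term>\<open>inv_into X \<phi>\<close> and \<^term>\<open>inv_into W \<phi>\<close> agree only
  on the image of \<open>X\<close>; the former is the inverse required of an isomorphism of varieties, the latter
  is the one known to be linear.
\<close>

lemma variety_morphism_linear:
  assumes lin: "linear_on s t W \<phi>" and "\<phi> ` W \<subseteq> U" and XW: "X \<subseteq> W" and XY: "\<phi> ` X \<subseteq> Y"
    and eq: "\<And>x. x \<in> X \<Longrightarrow> \<phi>' x = \<phi> x"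
  shows "variety_morphism s t W U X Y \<phi>'"
  unfolding variety_morphism_def
proof (intro conjI allI impI)
  show "\<phi>' ` X \<subseteq> Y" using XY eq by auto
  fix f assume "regular_function t U Y f"
  then obtain p where p: "polynomial_function t U p" "\<forall>y\<in>Y. f y = p y"
    by (auto simp: regular_function_def)
  have "\<forall>x\<in>X. (f \<circ> \<phi>') x = (p \<circ> \<phi>) x"
    using p(2) XY eq by auto
  with polynomial_function_compose_linear[OF p(1) assms(1,2)]
  show "regular_function s W X (f \<circ> \<phi>')"
    by (auto simp: regular_function_def)
qed

text \<open>
  The image of a closed set is closed because its equations are those of the original set composed
  with the linear inverse.
\<close>

lemma vs_iso_imp_variety_iso:
  assumes "module s" and iso: "vs_iso s t W U \<phi>"
    and X: "zariski_closed_in s W X" and Y: "\<phi> ` X = Y"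
  shows "variety_iso s t W U X Y \<phi>"
proof -
  let ?\<psi> = "inv_into W \<phi>"
  have iso': "vs_iso t s U W ?\<psi>" by (rule vs_iso_inv) fact+
  have lin: "linear_on s t W \<phi>" "linear_on t s U ?\<psi>"
    and bij: "bij_betw \<phi> W U" "bij_betw ?\<psi> U W"
    using iso iso' by (auto simp: vs_iso_def)
  have img: "\<phi> ` W \<subseteq> U" "?\<psi> ` U \<subseteq> W" using bij by (auto simp: bij_betw_def)
  obtain P where P: "\<And>p. p \<in> P \<Longrightarrow> polynomial_function s W p" "X = {x \<in> W. \<forall>p\<in>P. p x = 0}"
    using X by (auto simp: zariski_closed_in_def)
  have XW: "X \<subseteq> W" using P(2) by auto
  have YU: "Y \<subseteq> U" using XW Y img by auto
  have inj: "inj_on \<phi> W" using bij by (auto simp: bij_betw_def)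
  have \<psi>Y: "?\<psi> ` Y = X"
    unfolding Y[symmetric] by (rule inv_into_image_cancel[OF inj XW])
  have "Y = {y \<in> U. ?\<psi> y \<in> X}"
    using bij Y YU \<psi>Y by (auto simp: bij_betw_def f_inv_into_f image_iff)
  also have "\<dots> = {y \<in> U. \<forall>p\<in>(\<lambda>p. p \<circ> ?\<psi>) ` P. p y = 0}"
    using P(2) img by auto
  finally have "zariski_closed_in t U Y"
    unfolding zariski_closed_in_def
    by (intro exI[of _ "(\<lambda>p. p \<circ> ?\<psi>) ` P"] conjI)
      (auto intro!: polynomial_function_compose_linear[OF P(1) lin(2) img(2)])
  moreover have "bij_betw \<phi> X Y"
    using inj_on_subset[OF inj XW] Y by (simp add: bij_betw_def)
  moreover have "variety_morphism s t W U X Y \<phi>"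
    using lin img XW Y by (intro variety_morphism_linear) auto
  moreover have "inv_into X \<phi> y = ?\<psi> y" if "y \<in> Y" for y
    using that XW Y inj inj_on_subset[OF inj XW] by auto
  then have "variety_morphism t s U W Y X (inv_into X \<phi>)"
    using lin img YU \<psi>Y by (intro variety_morphism_linear[where \<phi> = ?\<psi>]) auto
  ultimately show ?thesis
    using X by (simp add: variety_iso_def)
qed

section \<open>Nilpotent endomorphisms\<close>

lemma (in vector_space) linear_power:
  assumes lin: "Vector_Spaces.linear scale scale x"
  shows "Vector_Spaces.linear scale scale (x ^^ k)"
  using lin by (induction k) (simp_all add: Vector_Spaces.linear_iff)

text \<open>
  The ranges of the powers of \<open>x\<close> form a decreasing chain of subspaces.  Once two consecutive ranges
  coincide the chain is constant, and by nilpotency the constant value is zero; until then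
  the dimension drops at each step.
\<close>

lemma (in finite_dimensional_vector_space) nilpotent_power_dimension:
  assumes lin: "Vector_Spaces.linear scale scale x" and nil: "nilpotent x"
  shows "x ^^ dimension = (\<lambda>_. 0)"
proof -
  obtain m where m: "x ^^ m = (\<lambda>_. 0)" using nil by (auto simp: nilpotent_def)
  interpret x: Vector_Spaces.linear scale scale x by fact
  have sub: "subspace (range (x ^^ k))" for k
  proof -
    interpret xk: Vector_Spaces.linear scale scale "x ^^ k"
      by (rule linear_power[OF lin])
    show ?thesis by (rule xk.subspace_image[OF subspace_UNIV])
  qed
  have step: "range (x ^^ Suc k) = x ` range (x ^^ k)" for k
    by auto
  have dec: "range (x ^^ Suc k) \<subseteq> range (x ^^ k)" for k
    by (auto simp: funpow_Suc_right simp del: funpow.simps)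
  have bound: "range (x ^^ k) = {0} \<or> dim (range (x ^^ k)) + k \<le> dimension" for k
  proof (induction k)
    case 0
    then show ?case by (simp add: dimension_def)
  next
    case (Suc k)
    show ?case
    proof (cases "range (x ^^ Suc k) = range (x ^^ k)")
      case True
      \<comment> \<open>The chain is constant from \<open>k\<close> on; comparing with the exponent \<open>m + k\<close> gives zero.\<close>
      have "range (x ^^ (j + k)) = range (x ^^ k)" for j
      proof (induction j)
        case (Suc j)
        then show ?case using True step[of "j + k"] step[of k] by simp
      qed simp
      from this[of m] have "range (x ^^ k) = {0}"
        unfolding funpow_add m by auto
      then show ?thesis using True by simp
    next
      case False
      with dec[of k] have "dim (range (x ^^ Suc k)) < dim (range (x ^^ k))"
        using sub by (intro dim_psubset) (simp add: span_eq_iff[THEN iffD2] psubset_eq del: funpow.simps)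
      moreover have "range (x ^^ k) \<noteq> {0}"
        using False step[of k] x.zero by (metis image_empty image_insert)
      ultimately show ?thesis using Suc by auto
    qed
  qed
  have "range (x ^^ dimension) \<subseteq> {0}"
    using bound[of dimension] dim_eq_0 by auto
  then show ?thesis by auto
qed

section \<open>The hyperbolic quadratic space in characteristic two\<close>

locale hyperbolic_space = vector_space s
  for s :: "'a::field \<Rightarrow> 'v::ab_group_add \<Rightarrow> 'v" +
  fixes n :: nat and e :: "nat \<Rightarrow> 'v"
  assumes char2: "CHAR('a) = 2" and basis: "is_basis s (2 * n) e"
begin

text \<open>
  A constant of its own, so that arithmetic simplification does not rewrite the dimension \<open>2 * n\<close>
  inside the coordinates.
\<close>

definition co :: "'v \<Rightarrow> nat \<Rightarrow> 'a" where "co = coord s (2 * n) e"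
abbreviation Q :: "'v \<Rightarrow> 'a" where "Q \<equiv> quad_form s n e"
abbreviation B :: "'v \<Rightarrow> 'v \<Rightarrow> 'a" where "B \<equiv> assoc_form Q"

sublocale finite_dimensional_vector_space s "e ` {1..2 * n}"
  using basis by unfold_locales (auto simp: is_basis_def)

lemma inj_e: "inj_on e {1..2 * n}"
  using basis by (simp add: is_basis_def)

lemma dimension_eq: "dimension = 2 * n"
  unfolding dimension_def by (simp add: card_image[OF inj_e] del: One_nat_def)

lemma add_self [simp]: "x + x = (0::'a)"
proof -
  have "(of_nat 2 :: 'a) = 0" using of_nat_CHAR[where 'a = 'a] by (simp only: char2)
  then have "(1 + 1) * x = 0" by simp
  then show ?thesis by (simp only: distrib_right mult_1_left)
qed

lemma square_add: "(x + y)\<^sup>2 = x\<^sup>2 + (y\<^sup>2 :: 'a)"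
proof -
  have "(x + y)\<^sup>2 = x\<^sup>2 + y\<^sup>2 + (x * y + x * y)"
    by (simp only: power2_eq_square distrib_left distrib_right add_ac mult_ac)
  then show ?thesis by simp
qed

lemma co_add [simp]: "co (v + w) i = co v i + co w i"
  using representation_add[OF independent_Basis, of w v] span_Basis by (simp add: co_def coord_def)

lemma co_scale [simp]: "co (s a v) i = a * co v i"
  using representation_scale[OF independent_Basis, of v a] span_Basis by (simp add: co_def coord_def)

lemma co_basis:
  assumes "i \<in> {1..2 * n}" "j \<in> {1..2 * n}"
  shows "co (e i) j = (if i = j then 1 else 0)"
  using representation_basis[OF independent_Basis, of "e i"] assms inj_on_eq_iff[OF inj_e]
  by (simp add: co_def coord_def eq_commute[of "e j"])

lemma co_expansion: "v = (\<Sum>i=1..2*n. s (co v i) (e i))"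
  using sum_representation_eq[OF independent_Basis, of v "e ` {1..2*n}"] span_Basis
  by (simp add: co_def coord_def sum.reindex[OF inj_e] del: One_nat_def)

lemma co_zero [simp]: "co 0 i = 0"
  using co_scale[of 0 0 i] by simp

lemma co_sum: "co (\<Sum>i\<in>I. f i) j = (\<Sum>i\<in>I. co (f i) j)"
  by (induction I rule: infinite_finite_induct) auto

lemma eq_zero_if_co_zero: "(\<And>i. i \<in> {1..2 * n} \<Longrightarrow> co v i = 0) \<Longrightarrow> v = 0"
  using co_expansion[of v] by simp

lemma Q_eq: "Q v = (\<Sum>i=1..n. co v i * co v (2 * n + 1 - i))"
  by (simp add: quad_form_def co_def)

lemma Q_scale: "Q (s a v) = a\<^sup>2 * Q v"
  by (simp add: Q_eq sum_distrib_left power2_eq_square mult_ac)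

lemma B_sym: "B v w = B w v"
  unfolding assoc_form_def by (subst add.commute) (simp add: algebra_simps)

text \<open>
  The \<open>n\<close> cross terms \<open>co v (2 * n + 1 - i) * co w i\<close> of the polarised form become the second half of
  the sum after the reflection \<open>i \<mapsto> 2 * n + 1 - i\<close> of the indices.  In this shape \<open>e i\<close> is visibly
  dual to \<open>e (2 * n + 1 - i)\<close>.
\<close>

lemma B_eq: "B v w = (\<Sum>i=1..2*n. co v i * co w (2 * n + 1 - i))"
proof -
  have "B v w = (\<Sum>i=1..n. co v i * co w (2*n+1-i)) + (\<Sum>i=1..n. co v (2*n+1-i) * co w i)"
    by (simp add: assoc_form_def Q_eq sum_subtractf[symmetric] sum.distrib[symmetric]
        algebra_simps)
  also have "(\<Sum>i=1..n. co v (2*n+1-i) * co w i) = (\<Sum>i=n+1..2*n. co v i * co w (2*n+1-i))"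
    by (rule sum.reindex_bij_witness[of _ "\<lambda>i. 2*n+1-i" "\<lambda>i. 2*n+1-i"]) auto
  also have "(\<Sum>i=1..n. co v i * co w (2*n+1-i)) + \<dots> = (\<Sum>i=1..2*n. co v i * co w (2*n+1-i))"
    using sum.ub_add_nat[of 1 n "\<lambda>i. co v i * co w (2*n+1-i)" n] by (simp add: mult_2)
  finally show ?thesis .
qed

lemma B_add_left: "B (v + v') w = B v w + B v' w"
  and B_add_right: "B v (w + w') = B v w + B v w'"
  and B_scale_left: "B (s a v) w = a * B v w"
  and B_scale_right: "B v (s a w) = a * B v w"
  by (simp_all add: B_eq algebra_simps sum.distrib sum_distrib_left)

lemma B_zero_left [simp]: "B 0 w = 0" and B_zero_right [simp]: "B v 0 = 0"
  by (simp_all add: B_eq)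

lemma B_self [simp]: "B v v = 0"
proof -
  have "v + v = s (1 + 1) v" by (simp only: scale_left_distrib scale_one)
  then have "v + v = 0" by simp
  moreover have "Q 0 = 0" by (simp add: Q_eq)
  moreover have "B v v = Q (v + v) - (Q v + Q v)" by (simp only: assoc_form_def diff_diff_eq)
  ultimately show ?thesis by (simp only: add_self diff_zero)
qed

lemma B_basis:
  assumes "i \<in> {1..2 * n}"
  shows "B (e i) w = co w (2 * n + 1 - i)"
proof -
  have "B (e i) w = (\<Sum>j=1..2*n. if i = j then co w (2 * n + 1 - j) else 0)"
    unfolding B_eq using assms by (intro sum.cong) (auto simp: co_basis)
  then show ?thesis using assms by simp
qed

lemma B_sum_left: "B (\<Sum>i\<in>I. f i) w = (\<Sum>i\<in>I. B (f i) w)"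
  by (induction I rule: infinite_finite_induct) (auto simp: B_add_left)

lemma B_nondegenerate:
  assumes "\<And>w. B v w = B v' w"
  shows "v = v'"
proof -
  have "co v i = co v' i" if "i \<in> {1..2 * n}" for i
  proof -
    have i': "2 * n + 1 - i \<in> {1..2 * n}" using that by auto
    have "B u (e (2 * n + 1 - i)) = co u i" for u
    proof -
      have "B u (e (2 * n + 1 - i)) = B (e (2 * n + 1 - i)) u"
        by (rule B_sym)
      also have "\<dots> = co u i" using B_basis[OF i'] that by simp
      finally show ?thesis .
    qed
    with assms[of "e (2 * n + 1 - i)"] show ?thesis by simp
  qed
  then show ?thesis using co_expansion[of v] co_expansion[of v'] by simp
qed

text \<open>
  The vector \<open>v\<close> with coordinates \<open>f (e i)\<close> in the dual basis \<open>e (2 * n + 1 - i)\<close> represents \<open>f\<close>.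
\<close>

lemma B_represents:
  assumes lin: "linear_on s (*) UNIV f"
  shows "\<exists>v. \<forall>w. B v w = f w"
proof -
  have add: "f (v + w) = f v + f w" and scale: "f (s a v) = a * f v" for v w a
    using lin by (auto simp: linear_on_def)
  have zero: "f 0 = 0" using scale[of 0 0] by simp
  have f_sum: "f (\<Sum>i\<in>I. g i) = (\<Sum>i\<in>I. f (g i))" for g :: "nat \<Rightarrow> 'v" and I
    by (induction I rule: infinite_finite_induct) (auto simp: add zero)
  define v where "v = (\<Sum>i=1..2*n. s (f (e i)) (e (2 * n + 1 - i)))"
  have "B v w = f w" for w
  proof -
    have "B v w = (\<Sum>i=1..2*n. f (e i) * co w i)"
      unfolding v_def B_sum_left B_scale_left
    proof (intro sum.cong refl)
      fix i assume i: "i \<in> {1..2 * n}"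
      then have "2 * n + 1 - i \<in> {1..2 * n}" by auto
      from B_basis[OF this] i show "f (e i) * B (e (2 * n + 1 - i)) w = f (e i) * co w i" by simp
    qed
    also have "\<dots> = f w"
      by (subst (2) co_expansion[of w]) (simp only: f_sum scale mult.commute)
    finally show ?thesis .
  qed
  then show ?thesis by blast
qed

lemma vector_space_mult: "vector_space ((*) :: 'a \<Rightarrow> 'a \<Rightarrow> 'a)"
  by unfold_locales (auto simp: algebra_simps)

sublocale vt: vector_space_prod "(*) :: 'a \<Rightarrow> 'a \<Rightarrow> 'a" s
  using vector_space_mult by (simp add: vector_space_prod_def vector_space_pair_def vector_space_axioms)

lemma tscale_Pair [simp]: "tscale s c (a, v) = (c * a, s c v)"
  by (simp add: vt.scale_def)

end

lemma vector_space_fun_scale: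
  assumes "vector_space t"
  shows "vector_space (fun_scale t)"
proof -
  interpret vector_space t by fact
  show ?thesis
    by unfold_locales (auto simp: fun_scale_def fun_eq_iff scale_right_distrib scale_left_distrib)
qed

context hyperbolic_space
begin

sublocale vf: vector_space "fun_scale s"
  by (rule vector_space_fun_scale) (rule vector_space_axioms)

sublocale vtf: vector_space "fun_scale (tscale s)"
  by (rule vector_space_fun_scale) (rule vt.p.vector_space_axioms)

sublocale vp: vector_space_prod s "fun_scale s"
  by (simp add: vector_space_prod_def vector_space_pair_def vector_space_axioms vf.vector_space_axioms)

lemma End_iff: "x \<in> End s \<longleftrightarrow> (\<forall>v w. x (v + w) = x v + x w) \<and> (\<forall>a v. x (s a v) = s a (x v))"
  by (simp add: End_def Vector_Spaces.linear_iff vector_space_axioms)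

lemma End_tscale_iff: "y \<in> End (tscale s) \<longleftrightarrow>
   (\<forall>v w. y (v + w) = y v + y w) \<and> (\<forall>a v. y (tscale s a v) = tscale s a (y v))"
  by (simp add: End_def Vector_Spaces.linear_iff vt.p.vector_space_axioms)

text \<open>
  The square of the \<open>e\<^sub>0\<close>-coordinate is additive in characteristic two, so it drops out of the
  associated form; in particular \<open>e\<^sub>0\<close> is in its radical.
\<close>

lemma assoc_form_tQ [simp]: "assoc_form (tQ Q) (a, v) (b, w) = B v w"
proof -
  show ?thesis by (simp add: assoc_form_def tQ_def square_add)
qed

section \<open>The linear isomorphism and its equivariance under \<open>O(V)\<close>\<close>

lemma t\<Psi>_apply: "t\<Psi> s Q (v, x) (a, w) = (B v w, x w)"
  by (simp add: t\<Psi>_def \<delta>_def i_emb_def incl_def e\<^sub>0_def)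

lemma subspace_o_V: "vf.subspace (o_V s Q)"
  unfolding vf.subspace_def
  by (auto simp: o_V_def End_iff fun_scale_def B_add_left B_scale_left scale_right_distrib
      algebra_simps)

lemma subspace_V_plus_o: "vp.p.subspace (V_plus_o s Q)"
  unfolding V_plus_o_def by (intro vp.subspace_Times subspace_o_V subspace_UNIV)

lemma subspace_o_tV: "vtf.subspace (o_tV s Q)"
proof -
  have [simp]: "assoc_form (tQ Q) 0 w = 0" for w
    by (cases w) (simp add: zero_prod_def)
  have "assoc_form (tQ Q) (u + u') w = assoc_form (tQ Q) u w + assoc_form (tQ Q) u' w"
     "assoc_form (tQ Q) (tscale s c u) w = c * assoc_form (tQ Q) u w" for u u' w c
    by (cases u; cases u'; cases w; simp add: B_add_left B_scale_left)+
  then show ?thesis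
    unfolding vtf.subspace_def
    by (auto simp: o_tV_def End_tscale_iff fun_scale_def vt.p.scale_right_distrib
        algebra_simps)
qed

lemma t\<Psi>_in_o_tV:
  assumes "p \<in> V_plus_o s Q"
  shows "t\<Psi> s Q p \<in> o_tV s Q"
proof -
  obtain v x where p: "p = (v, x)" by (cases p)
  have x: "x \<in> End s" "\<And>w. B (x w) w = 0"
    using assms by (auto simp: p V_plus_o_def o_V_def)
  have "x 0 = 0" using x(1) by (metis End_iff scale_zero_left)
  then show ?thesis
    using x unfolding p o_tV_def End_tscale_iff End_iff
    by (auto simp: t\<Psi>_apply e\<^sub>0_def incl_def B_add_right B_scale_right zero_prod_def)
qed

text \<open>
  Since \<open>y\<close> kills \<open>e\<^sub>0\<close>, it is determined by its restriction to \<open>V\<close>; the first component of this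
  restriction is represented by a vector, and the second is the required endomorphism.
\<close>

lemma t\<Psi>_surj:
  assumes y: "y \<in> o_tV s Q"
  shows "\<exists>p\<in>V_plus_o s Q. t\<Psi> s Q p = y"
proof -
  have add: "y (u + w) = y u + y w" and scale: "y (tscale s c u) = tscale s c (y u)" for u w c
    using y unfolding o_tV_def End_tscale_iff by blast+
  have y0: "y (1, 0) = (0, 0)" and alt: "assoc_form (tQ Q) (y (0, v)) (0, v) = 0" for v
    using y by (auto simp: o_tV_def e\<^sub>0_def incl_def zero_prod_def)
  have y0': "y (a, w) = y (0, w)" for a w
  proof -
    have "y (a, w) = tscale s a (y (1, 0)) + y (0, w)"
      by (simp flip: scale add)
    then show ?thesis by (simp add: y0 flip: zero_prod_def)
  qed
  define x where "x = (\<lambda>w. snd (y (0, w)))"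
  have "y (0, v + w) = y (0, v) + y (0, w)" "y (0, s c v) = tscale s c (y (0, v))" for v w c
    by (simp_all flip: scale add)
  then have *: "linear_on s (*) UNIV (\<lambda>w. fst (y (0, w)))" "x \<in> End s"
    by (auto simp: linear_on_def End_iff x_def vt.scale_def)
  from B_represents[OF *(1)] obtain v where v: "\<And>w. B v w = fst (y (0, w))" by auto
  have "B (x w) w = 0" for w
    using alt[of w] by (cases "y (0, w)") (simp add: x_def)
  with * have "(v, x) \<in> V_plus_o s Q" by (simp add: V_plus_o_def o_V_def)
  moreover have "t\<Psi> s Q (v, x) = y"
  proof
    fix u show "t\<Psi> s Q (v, x) u = y u"
      using y0'[of "fst u" "snd u"] by (cases u) (simp add: t\<Psi>_apply v x_def)
  qed
  ultimately show ?thesis by blast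
qed

lemma t\<Psi>_inj: "inj (t\<Psi> s Q)"
proof (rule injI)
  fix p q assume eq: "t\<Psi> s Q p = t\<Psi> s Q q"
  obtain v x v' x' where pq: "p = (v, x)" "q = (v', x')" by (cases p, cases q)
  have "B v w = B v' w \<and> x w = x' w" for w
    using fun_cong[OF eq, of "(0, w)"] by (simp add: pq t\<Psi>_apply)
  then show "p = q" using B_nondegenerate[of v v'] by (auto simp: pq)
qed

lemma vs_iso_t\<Psi>:
  "vs_iso (V_plus_o_scale s) (fun_scale (tscale s)) (V_plus_o s Q) (o_tV s Q) (t\<Psi> s Q)"
proof -
  have "linear_on (V_plus_o_scale s) (fun_scale (tscale s)) (V_plus_o s Q) (t\<Psi> s Q)"
    by (auto simp: linear_on_def fun_eq_iff t\<Psi>_apply B_add_left B_scale_left vp.scale_def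
        fun_scale_def)
  moreover have "bij_betw (t\<Psi> s Q) (V_plus_o s Q) (o_tV s Q)"
    using t\<Psi>_in_o_tV t\<Psi>_surj inj_on_subset[OF t\<Psi>_inj]
    by (fastforce simp: bij_betw_def)
  ultimately show ?thesis
    by (simp add: vs_iso_def subspace_V_plus_o subspace_o_tV)
qed

lemma equivariant_t\<Psi>:
  fixes X :: "('v \<times> ('v \<Rightarrow> 'v)) set"
  shows "equivariant_on (O_group s Q) V_plus_o_act (\<lambda>g. conj_act (extend_O g)) X (t\<Psi> s Q)"
  unfolding equivariant_on_def
proof (intro ballI)
  fix g and p :: "'v \<times> ('v \<Rightarrow> 'v)"
  assume g: "g \<in> O_group s Q"
  obtain v x where p: "p = (v, x)" by (cases p)
  have bij: "bij g" and add: "\<And>v w. g (v + w) = g v + g w" and Qg: "\<And>v. Q (g v) = Q v"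
    using g by (auto simp: O_group_def GL_def End_iff)
  have Bg: "B (g v) (g w) = B v w" for v w
    by (simp add: assoc_form_def Qg flip: add)
  have inv: "inv (extend_O g :: 'a \<times> 'v \<Rightarrow> _) = extend_O (inv g)"
    by (rule inv_equality)
      (auto simp: extend_O_def bij bij_is_inj bij_is_surj surj_f_inv_f)
  show "t\<Psi> s Q (V_plus_o_act g p) = conj_act (extend_O g) (t\<Psi> s Q p)"
  proof
    fix u :: "'a \<times> 'v" obtain a w where u: "u = (a, w)" by (cases u)
    have "B (g v) w = B v (inv g w)"
      using Bg[of v "inv g w"] by (simp add: bij bij_is_surj surj_f_inv_f)
    then show "t\<Psi> s Q (V_plus_o_act g p) u = conj_act (extend_O g) (t\<Psi> s Q p) u"
      unfolding p u V_plus_o_act_def conj_act_def inv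
      by (simp add: extend_O_def t\<Psi>_apply)
  qed
qed

section \<open>The nilpotent cones\<close>

lemma t\<Psi>_power: "(t\<Psi> s Q (v, x) ^^ Suc k) (a, w) = (B v ((x ^^ k) w), (x ^^ Suc k) w)"
  by (induction k) (simp_all add: t\<Psi>_apply)

text \<open>
  One exponent more than for \<open>x\<close> is needed, since the first component of a power of \<open>t\<Psi> (v, x)\<close>
  lags one step behind the second.
\<close>

lemma nilpotent_t\<Psi>_iff:
  assumes "x \<in> End s"
  shows "nilpotent (t\<Psi> s Q (v, x)) \<longleftrightarrow> nilpotent x"
proof
  assume "nilpotent (t\<Psi> s Q (v, x))"
  then obtain k where "t\<Psi> s Q (v, x) ^^ k = (\<lambda>_. 0)" by (auto simp: nilpotent_def)
  then have "t\<Psi> s Q (v, x) ^^ Suc k = (\<lambda>_. t\<Psi> s Q (v, x) 0)"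
    by (simp add: comp_def)
  moreover have "x 0 = 0" using assms by (metis End_iff scale_zero_left)
  ultimately have "x ^^ Suc k = (\<lambda>_. 0)"
    using t\<Psi>_power[where v = v and x = x and k = k and a = 0] by (auto simp: fun_eq_iff t\<Psi>_apply zero_prod_def simp del: funpow.simps)
  then show "nilpotent x" unfolding nilpotent_def by blast
next
  assume "nilpotent x"
  then obtain k where k: "x ^^ k = (\<lambda>_. 0)" by (auto simp: nilpotent_def)
  have "x 0 = 0" using assms by (metis End_iff scale_zero_left)
  then have "x ^^ Suc k = (\<lambda>_. 0)" using k by (simp add: comp_def)
  then have "t\<Psi> s Q (v, x) ^^ Suc k = (\<lambda>_. 0)"
    using t\<Psi>_power[where v = v and x = x and k = k] k by (auto simp: fun_eq_iff zero_prod_def simp del: funpow.simps)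
  then show "nilpotent (t\<Psi> s Q (v, x))" unfolding nilpotent_def by blast
qed

lemma t\<Psi>_image_exotic_nilcone: "t\<Psi> s Q ` exotic_nilcone s Q = nilcone_o_tV s Q"
proof -
  have nil: "nilpotent (t\<Psi> s Q p) \<longleftrightarrow> nilpotent (snd p)" if "p \<in> V_plus_o s Q" for p
    using that nilpotent_t\<Psi>_iff[of "snd p" "fst p"] by (auto simp: V_plus_o_def o_V_def)
  have cone: "exotic_nilcone s Q = {p \<in> V_plus_o s Q. nilpotent (snd p)}"
    by (auto simp: exotic_nilcone_def)
  show ?thesis
  proof
    show "t\<Psi> s Q ` exotic_nilcone s Q \<subseteq> nilcone_o_tV s Q"
      unfolding cone nilcone_o_tV_def using nil t\<Psi>_in_o_tV by blast
    show "nilcone_o_tV s Q \<subseteq> t\<Psi> s Q ` exotic_nilcone s Q"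
    proof
      fix y assume "y \<in> nilcone_o_tV s Q"
      then have y: "y \<in> o_tV s Q" "nilpotent y" by (simp_all add: nilcone_o_tV_def)
      from t\<Psi>_surj[OF y(1)] obtain p where p: "p \<in> V_plus_o s Q" "t\<Psi> s Q p = y" by blast
      with nil y have "p \<in> exotic_nilcone s Q" unfolding cone by blast
      with p show "y \<in> t\<Psi> s Q ` exotic_nilcone s Q" by blast
    qed
  qed
qed

text \<open>
  The entries of \<open>x ^^ Suc k\<close> are, by matrix multiplication, sums of products of entries of \<open>x ^^ k\<close>
  and of \<open>x\<close>, and the latter are linear in \<open>x\<close>.
\<close>

lemma polynomial_function_power_entry:
  "polynomial_function (V_plus_o_scale s) (V_plus_o s Q) (\<lambda>p. co ((snd p ^^ k) (e j)) i)"
proof (induction k arbitrary: i)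
  case 0
  show ?case by (simp add: polynomial_function.const)
next
  case (Suc k)
  have "polynomial_function (V_plus_o_scale s) (V_plus_o s Q) (\<lambda>p. co (snd p (e l)) i)" for l
    by (rule polynomial_function.functional) (simp add: linear_on_def vp.scale_def fun_scale_def)
  from polynomial_function.mult[OF Suc this]
  have "polynomial_function (V_plus_o_scale s) (V_plus_o s Q)
      (\<lambda>p. \<Sum>l=1..2*n. co ((snd p ^^ k) (e j)) l * co (snd p (e l)) i)"
    by (intro polynomial_function_sum)
  then show ?case
  proof (rule polynomial_function_cong[OF vp.p.module_axioms subspace_V_plus_o])
    fix p assume "p \<in> V_plus_o s Q"
    then interpret x: Vector_Spaces.linear s s "snd p"
      by (auto simp: V_plus_o_def o_V_def End_def)
    have "(snd p ^^ Suc k) (e j) = snd p (\<Sum>l=1..2*n. s (co ((snd p ^^ k) (e j)) l) (e l))"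
      by (simp flip: co_expansion[of "(snd p ^^ k) (e j)"] del: One_nat_def)
    also have "\<dots> = (\<Sum>l=1..2*n. s (co ((snd p ^^ k) (e j)) l) (snd p (e l)))"
      by (simp add: x.sum x.scale)
    finally show "co ((snd p ^^ Suc k) (e j)) i
        = (\<Sum>l=1..2*n. co ((snd p ^^ k) (e j)) l * co (snd p (e l)) i)"
      by (simp only: co_sum co_scale)
  qed
qed

lemma zariski_closed_exotic_nilcone:
  "zariski_closed_in (V_plus_o_scale s) (V_plus_o s Q) (exotic_nilcone s Q)"
proof -
  let ?P = "{\<lambda>p. co ((snd p ^^ (2 * n)) (e j)) i | i j. j \<in> {1..2 * n} \<and> i \<in> {1..2*n}}"
  have "nilpotent x \<longleftrightarrow> (\<forall>j\<in>{1..2*n}. \<forall>i\<in>{1..2*n}. co ((x ^^ (2 * n)) (e j)) i = 0)"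
    if "x \<in> o_V s Q" for x
  proof
    have lin: "Vector_Spaces.linear s s x"
      using that by (simp add: o_V_def End_def)
    show "\<forall>j\<in>{1..2*n}. \<forall>i\<in>{1..2*n}. co ((x ^^ (2 * n)) (e j)) i = 0" if "nilpotent x"
      using nilpotent_power_dimension[OF lin that] unfolding dimension_eq by simp
    assume "\<forall>j\<in>{1..2*n}. \<forall>i\<in>{1..2*n}. co ((x ^^ (2 * n)) (e j)) i = 0"
    then have zero: "(x ^^ (2 * n)) (e j) = 0" if "j \<in> {1..2*n}" for j
      using that eq_zero_if_co_zero by blast
    interpret x: Vector_Spaces.linear s s "x ^^ (2 * n)"
      by (rule linear_power[OF lin])
    have "(x ^^ (2 * n)) w = 0" for w
      by (subst co_expansion[of w])
        (simp add: x.sum x.scale zero)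
    then show "nilpotent x" unfolding nilpotent_def by blast
  qed
  then have "exotic_nilcone s Q = {p \<in> V_plus_o s Q. \<forall>f\<in>?P. f p = 0}"
    by (fastforce simp: exotic_nilcone_def V_plus_o_def)
  moreover have "\<forall>f\<in>?P. polynomial_function (V_plus_o_scale s) (V_plus_o s Q) f"
    using polynomial_function_power_entry by blast
  ultimately show ?thesis unfolding zariski_closed_in_def by blast
qed

section \<open>Failure of equivariance under the larger orthogonal group\<close>

text \<open>
  These endomorphisms correspond to the wedge products of \<open>a\<close> and \<open>b\<close>: pairing the image of \<open>w\<close>
  with \<open>w\<close> gives the product \<open>B a w * B b w\<close> twice, which cancels.
\<close>

lemma rank_two_in_o_V:
  "(\<lambda>w. s (B a w) b + s (B b w) a) \<in> o_V s Q"
  by (auto simp: o_V_def End_iff B_add_left B_add_right B_scale_left B_scale_right B_sym[of _ a]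
      algebra_simps mult.commute)

lemma rank_two_nilpotent:
  assumes "B a b = 0"
  shows "nilpotent (\<lambda>w. s (B a w) b + s (B b w) a)"
  unfolding nilpotent_def
  by (rule exI[of _ 2])
    (auto simp: numeral_2_eq_2 fun_eq_iff B_add_right B_scale_right assms B_sym[of b a])

text \<open>
  The symplectic transvection \<open>v \<mapsto> v + B u v u\<close> at a singular vector changes \<open>Q v\<close> by the
  square of \<open>B u v\<close>.  Adding \<open>B u v\<close> to the \<open>e\<^sub>0\<close>-coordinate compensates this change, since squaring
  is additive.
\<close>

lemma transvection_lift_in_O_tQ:
  assumes "Q u = 0"
  defines "h \<equiv> \<lambda>(a, v). (a + B u v, v + s (B u v) u)"
  shows "h \<in> O_group (tscale s) (tQ Q)" and "h \<circ> h = id"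
proof -
  show hh: "h \<circ> h = id"
    by (auto simp: h_def fun_eq_iff B_add_right B_scale_right add.assoc
        simp flip: scale_left_distrib)
  have "bij h" by (rule o_bij[OF hh hh])
  moreover have "h \<in> End (tscale s)"
    by (auto simp: End_tscale_iff h_def B_add_right B_scale_right algebra_simps)
  moreover have "tQ Q (h (a, v)) = tQ Q (a, v)" for a v
  proof -
    define t where "t = B u v"
    have Qs: "Q (s t u) = 0"
      by (simp add: Q_scale assms)
    have "Q (v + s t u) = Q v + Q (s t u) + B v (s t u)"
      by (simp add: assoc_form_def)
    also have "\<dots> = Q v + t * t"
      by (simp add: Qs B_scale_right B_sym[of v u] flip: t_def)
    finally have Qv: "Q (v + s t u) = Q v + t * t" .
    have "tQ Q (h (a, v)) = (a + t)\<^sup>2 + Q (v + s t u)"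
      by (simp add: h_def tQ_def t_def)
    also have "\<dots> = a\<^sup>2 + t\<^sup>2 + (Q v + t * t)"
      by (simp add: Qv square_add)
    also have "\<dots> = a\<^sup>2 + Q v + (t\<^sup>2 + t\<^sup>2)"
      by (simp only: power2_eq_square add_ac)
    finally show ?thesis by (simp add: tQ_def)
  qed
  ultimately show "h \<in> O_group (tscale s) (tQ Q)"
    by (auto simp: O_group_def GL_def)
qed

text \<open>
  The counterexample has \<open>V\<close>-component \<open>0\<close>.  As \<open>\<Gamma> h 0 = 0\<close>, acting first and then applying \<open>t\<Psi>\<close>
  gives an endomorphism with image in \<open>V\<close>, whereas conjugating \<open>t\<Psi> (0, x)\<close> with the lifted transvection \<open>h\<close> produces the \<open>e\<^sub>0\<close>-component \<open>B u (x w)\<close> at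
  \<open>h (0, w)\<close>.
\<close>

lemma not_equivariant_t\<Psi>:
  assumes n: "n \<ge> 2"
  shows "\<not> equivariant_on (O_group (tscale s) (tQ Q)) (\<lambda>h. V_plus_o_act (\<Gamma> h)) conj_act
           (exotic_nilcone s Q) (t\<Psi> s Q)"
proof
  assume eqv: "equivariant_on (O_group (tscale s) (tQ Q)) (\<lambda>h. V_plus_o_act (\<Gamma> h)) conj_act
           (exotic_nilcone s Q) (t\<Psi> s Q)"
  \<comment> \<open>\<open>a\<close> and \<open>b\<close> span a totally isotropic plane, with \<open>u\<close> dual to \<open>a\<close> and \<open>w\<close> dual to \<open>b\<close>;
      \<open>n \<ge> 2\<close> makes the four indices distinct.\<close>
  define a b u w where "a = e 1" "b = e 2" "u = e (2 * n)" "w = e (2 * n - 1)"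
  note d = this
  have vals: "B a b = 0" "B u a = 1" "B u b = 0"
    "B a w = 0" "B b w = 1"
    using n by (simp_all add: d B_basis co_basis)
  have "Q u = 0"
    using n unfolding Q_eq d by (intro sum.neutral) (auto simp: co_basis)
  define x where "x = (\<lambda>w. s (B a w) b + s (B b w) a)"
  define h :: "'a \<times> 'v \<Rightarrow> 'a \<times> 'v" where "h = (\<lambda>(a, v). (a + B u v, v + s (B u v) u))"
  have h: "h \<in> O_group (tscale s) (tQ Q)" and hh: "h \<circ> h = id"
    using transvection_lift_in_O_tQ[OF \<open>Q u = 0\<close>] by (simp_all add: h_def)
  have "(0, x) \<in> exotic_nilcone s Q"
    using rank_two_in_o_V rank_two_nilpotent[OF vals(1)]
    by (auto simp: exotic_nilcone_def V_plus_o_def x_def)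
  with eqv h have eq: "t\<Psi> s Q (V_plus_o_act (\<Gamma> h) (0, x)) = conj_act h (t\<Psi> s Q (0, x))"
    by (simp add: equivariant_on_def)
  have inv: "inv h (h z) = z" for z
    using hh by (metis comp_apply id_apply inv_f_f injI)
  have "fst (t\<Psi> s Q (V_plus_o_act (\<Gamma> h) (0, x)) z) = 0" for z
    by (cases z) (simp add: V_plus_o_act_def t\<Psi>_apply \<Gamma>_def h_def incl_def)
  moreover have "fst (conj_act h (t\<Psi> s Q (0, x)) (h (0, w))) = B u (x w)"
    by (simp add: conj_act_def inv t\<Psi>_apply) (simp add: h_def)
  moreover have "B u (x w) = 1"
    by (simp add: x_def B_add_right B_scale_right vals)
  ultimately show False using eq by simp
qed

end

section \<open>The exotic nilpotent cone and the nilpotent cone of \<open>o_tV\<close>\<close>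

theorem proposition4p1:
  fixes s :: "'a::alg_closed_field \<Rightarrow> 'v::ab_group_add \<Rightarrow> 'v"
    and n :: nat and e :: "nat \<Rightarrow> 'v" and Q :: "'v \<Rightarrow> 'a"
  assumes char2: "CHAR('a) = 2"
    and V: "vector_space s"
    and basis: "is_basis s (2 * n) e"
    and Q: "Q = quad_form s n e"
  shows "vs_iso (V_plus_o_scale s) (fun_scale (tscale s)) (V_plus_o s Q) (o_tV s Q) (t\<Psi> s Q) \<and>
    equivariant_on (O_group s Q) V_plus_o_act (\<lambda>g. conj_act (extend_O g))
           (V_plus_o s Q) (t\<Psi> s Q) \<and>
    variety_iso (V_plus_o_scale s) (fun_scale (tscale s)) (V_plus_o s Q) (o_tV s Q)
           (exotic_nilcone s Q) (nilcone_o_tV s Q) (t\<Psi> s Q) \<and>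
    equivariant_on (O_group s Q) V_plus_o_act (\<lambda>g. conj_act (extend_O g))
           (exotic_nilcone s Q) (t\<Psi> s Q) \<and>
    (n \<ge> 2 \<longrightarrow> \<not> equivariant_on (O_group (tscale s) (tQ Q)) (\<lambda>h. V_plus_o_act (\<Gamma> h)) conj_act
           (exotic_nilcone s Q) (t\<Psi> s Q))"
proof -
  interpret V: vector_space s by fact
  interpret H: hyperbolic_space s n e
    using char2 basis by unfold_locales
  show ?thesis
    unfolding Q
    using H.vs_iso_t\<Psi> H.equivariant_t\<Psi> H.not_equivariant_t\<Psi>
      vs_iso_imp_variety_iso[OF H.vp.p.module_axioms H.vs_iso_t\<Psi>
        H.zariski_closed_exotic_nilcone H.t\<Psi>_image_exotic_nilcone]
    by blast
qed

end
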